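(* Let $\mathcal{A},\mathcal{B}$ be sets, $\mathcal{C}\subset\mathbb{R}$, and let $s_{y|x}:\mathbb{R}^D\to\mathbb{R}$ be continuously differentiable for all $x\in\mathcal{B}$, $y\in\mathcal{A}$. Assume that $\ell:\mathbb{R}\times\mathcal{C}\to\mathbb{R}$ is twice continuously differentiable in its first variable, that $\mathcal{C}$ has a maximum, and that $\partial_s\ell(s,\max\mathcal{C})<0$ for all $s\in\mathbb{R}$. Suppose the regularization is $\mathcal{R}=0$. Then at any $\theta\in\mathbb{R}^D$, and with respect to the addition of any unequivocal comparison $(x,y,z,\max\mathcal{C})$ with $(x,y,z)\in\mathcal{B}\times\mathcal{A}\times\mathcal{A}$, the following implications hold: (1) $\nabla s_{yz|x}(\theta)\ne 0$ implies pairwise gradient-descent monotonicity; (2) $\nabla s_{yz|x}(\theta)^T\nabla s_{y|x}(\theta)>0$ implies individual-score gradient-descent monotonicity; (3) if $\nabla s_{yw|x}(\theta)^T\nabla s_{yz|x}(\theta)>0$ for all $w\in\mathcal{A}\setminus\{y\}$, then fully-pairwise gradient-descent monotonicity holds.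
   Context: $s_{y|x}(\theta)\in\mathbb{R}$ is the score of alternative $y\in\mathcal{A}$ under background $x\in\mathcal{B}$ at parameter $\theta\in\mathbb{R}^D$, and $s_{yz|x}(\theta)=s_{y|x}(\theta)-s_{z|x}(\theta)$. $\ell$ is the per-data loss, where the total loss on a dataset $\mathbf{D}$ (finite multiset of $(x,y,z,c)\in\mathcal{B}\times\mathcal{A}\times\mathcal{A}\times\mathcal{C}$) is $\mathcal{R}(\theta)+\sum_{(x,y,z,c)\in\mathbf{D}}\ell(s_{yz|x}(\theta),c)$. Gradients are in $\theta$. Given $(x,y,z)$, $\theta$ and $\varepsilon\ge 0$, let $\theta^\varepsilon=\theta-\varepsilon\nabla_\theta[\ell(s_{yz|x}(\theta),\max\mathcal{C})]$. The loss (with $\mathcal{R}=0$) is pairwise gradient-descent monotone with respect to the addition of an unequivocal comparison at $(x,y,z)$ and $\theta$ if there is $\varepsilon_0>0$ such that for all $0\le\varepsilon\le\varepsilon_0$, $s_{yz|x}(\theta^\varepsilon)\ge s_{yz|x}(\theta)$. Individual-score gradient-descent monotonicity is defined by replacing the last condition by $s_{y|x}(\theta^\varepsilon)\ge s_{y|x}(\theta)$, and fully-pairwise gradient-descent monotonicity by replacing it by: for all $w\in\mathcal{A}\setminus\{y\}$, $s_{yw|x}(\theta^\varepsilon)\ge s_{yw|x}(\theta)$.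
   Formalization: In (3), fully-pairwise monotonicity (one ε₀ for all w) is claimed only for finite 𝒜; for arbitrary 𝒜 each w ∈ 𝒜∖{y} gets its own ε₀. With infinite 𝒜 the uniform claim is false (scores θ, 0, nθ² at θ = 0). Also D ≥ 1. *)

theory Defs
  imports "HOL-Analysis.Analysis"
begin

definition gradient :: "('n::real_inner \<Rightarrow> real) \<Rightarrow> 'n \<Rightarrow> 'n" where
  "gradient f \<theta> = (THE g. GDERIV f \<theta> :> g)"

definition continuously_differentiable :: "('n::euclidean_space \<Rightarrow> real) \<Rightarrow> bool" where
  "continuously_differentiable f \<longleftrightarrow> f differentiable_on UNIV \<and> continuous_on UNIV (gradient f)"

definition twice_continuously_differentiable :: "(real \<Rightarrow> real) \<Rightarrow> bool" where
  "twice_continuously_differentiable f \<longleftrightarrow>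
     f differentiable_on UNIV \<and> deriv f differentiable_on UNIV \<and>
     continuous_on UNIV (deriv (deriv f))"

definition has_maximum :: "real set \<Rightarrow> bool" where
  "has_maximum C \<longleftrightarrow> (\<exists>m\<in>C. \<forall>c\<in>C. c \<le> m)"

(* C may be infinite, so Max, which is meaningful on finite sets only, cannot be used. *)
definition maximum :: "real set \<Rightarrow> real" where
  "maximum C = (GREATEST c. c \<in> C)"

(* s y x \<theta> is the score of alternative y under background x at parameter \<theta>. *)
definition score_diff ::
  "('a \<Rightarrow> 'b \<Rightarrow> 'n \<Rightarrow> real) \<Rightarrow> 'a \<Rightarrow> 'a \<Rightarrow> 'b \<Rightarrow> 'n \<Rightarrow> real" where
  "score_diff s y z x \<theta> = s y x \<theta> - s z x \<theta>"

(* With zero regularization, one gradient step of size \<epsilon> on the loss of the single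
   comparison (x, y, z, max C). *)
definition gd_step ::
  "('a \<Rightarrow> 'b \<Rightarrow> 'n \<Rightarrow> real) \<Rightarrow> (real \<Rightarrow> real \<Rightarrow> real) \<Rightarrow> real set \<Rightarrow>
   'b \<Rightarrow> 'a \<Rightarrow> 'a \<Rightarrow> 'n::real_inner \<Rightarrow> real \<Rightarrow> 'n" where
  "gd_step s l C x y z \<theta> \<epsilon> =
     \<theta> - \<epsilon> *\<^sub>R gradient (\<lambda>\<theta>'. l (score_diff s y z x \<theta>') (maximum C)) \<theta>"

definition pairwise_gd_monotone ::
  "('a \<Rightarrow> 'b \<Rightarrow> 'n \<Rightarrow> real) \<Rightarrow> (real \<Rightarrow> real \<Rightarrow> real) \<Rightarrow> real set \<Rightarrow>
   'b \<Rightarrow> 'a \<Rightarrow> 'a \<Rightarrow> 'n::real_inner \<Rightarrow> bool" where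
  "pairwise_gd_monotone s l C x y z \<theta> \<longleftrightarrow>
     (\<exists>\<epsilon>\<^sub>0>0. \<forall>\<epsilon>. 0 \<le> \<epsilon> \<and> \<epsilon> \<le> \<epsilon>\<^sub>0 \<longrightarrow>
        score_diff s y z x (gd_step s l C x y z \<theta> \<epsilon>) \<ge> score_diff s y z x \<theta>)"

definition individual_gd_monotone ::
  "('a \<Rightarrow> 'b \<Rightarrow> 'n \<Rightarrow> real) \<Rightarrow> (real \<Rightarrow> real \<Rightarrow> real) \<Rightarrow> real set \<Rightarrow>
   'b \<Rightarrow> 'a \<Rightarrow> 'a \<Rightarrow> 'n::real_inner \<Rightarrow> bool" where
  "individual_gd_monotone s l C x y z \<theta> \<longleftrightarrow>
     (\<exists>\<epsilon>\<^sub>0>0. \<forall>\<epsilon>. 0 \<le> \<epsilon> \<and> \<epsilon> \<le> \<epsilon>\<^sub>0 \<longrightarrow>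
        s y x (gd_step s l C x y z \<theta> \<epsilon>) \<ge> s y x \<theta>)"

(* The threshold \<epsilon>\<^sub>0 is uniform in w.  For infinite A this cannot be deduced from conditions on
   the gradients at \<theta> alone: take scores \<theta> for y, 0 for z and n * \<theta>^2 for the n-th further
   alternative, on the real line at \<theta> = 0. *)
definition fully_pairwise_gd_monotone ::
  "'a set \<Rightarrow> ('a \<Rightarrow> 'b \<Rightarrow> 'n \<Rightarrow> real) \<Rightarrow> (real \<Rightarrow> real \<Rightarrow> real) \<Rightarrow> real set \<Rightarrow>
   'b \<Rightarrow> 'a \<Rightarrow> 'a \<Rightarrow> 'n::real_inner \<Rightarrow> bool" where
  "fully_pairwise_gd_monotone A s l C x y z \<theta> \<longleftrightarrow>
     (\<exists>\<epsilon>\<^sub>0>0. \<forall>\<epsilon>. 0 \<le> \<epsilon> \<and> \<epsilon> \<le> \<epsilon>\<^sub>0 \<longrightarrow>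
        (\<forall>w\<in>A - {y}. score_diff s y w x (gd_step s l C x y z \<theta> \<epsilon>) \<ge> score_diff s y w x \<theta>))"

end

theory Submission
  imports Defs
begin

text \<open>
  By the chain rule the gradient step moves \<open>\<theta>\<close> along a positive multiple of the gradient of the score
  difference, the factor being minus the derivative of the loss. Hence a score function whose
  gradient has a positive inner product with that of the score difference has a positive derivative
  along the step at \<open>\<epsilon> = 0\<close>, and increases for small \<open>\<epsilon>\<close>.
\<close>

lemma gradient_eqI:
  assumes "GDERIV f \<theta> :> g"
  shows "gradient f \<theta> = g"
  unfolding gradient_def
proof (rule the_equality)
  fix g' assume "GDERIV f \<theta> :> g'"
  with assms have "(\<lambda>h. h \<bullet> g') = (\<lambda>h. h \<bullet> g)"
    unfolding gderiv_def by (rule has_derivative_unique[rotated])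
  then show "g' = g"
    by (metis inner_commute vector_eq_rdot)
qed (fact assms)

text \<open>Riesz representation in finite dimension: a linear functional \<open>f'\<close> is the
  inner product with \<open>adjoint f' 1\<close>. This guarantees that the description in
  \<open>gradient\<close> denotes an actual gradient.\<close>

lemma differentiable_imp_GDERIV:
  fixes f :: "'n::euclidean_space \<Rightarrow> real"
  assumes "f differentiable (at \<theta>)"
  shows "GDERIV f \<theta> :> gradient f \<theta>"
proof -
  obtain f' where f': "(f has_derivative f') (at \<theta>)"
    using assms by (auto simp: differentiable_def)
  then have "linear f'"
    by (rule has_derivative_linear)
  then have "f' = (\<lambda>h. h \<bullet> adjoint f' 1)"
    by (simp add: adjoint_works)
  with f' have "GDERIV f \<theta> :> adjoint f' 1"
    unfolding gderiv_def by metis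
  then show ?thesis
    by (simp add: gradient_eqI)
qed

lemma continuously_differentiable_imp_GDERIV:
  "continuously_differentiable f \<Longrightarrow> GDERIV f \<theta> :> gradient f \<theta>"
  by (simp add: continuously_differentiable_def differentiable_on_def differentiable_imp_GDERIV)

lemma GDERIV_score_diff:
  assumes "continuously_differentiable (s y x)" "continuously_differentiable (s z x)"
  shows "GDERIV (score_diff s y z x) \<theta> :> gradient (score_diff s y z x) \<theta>"
proof -
  have "GDERIV (score_diff s y z x) \<theta> :> gradient (s y x) \<theta> - gradient (s z x) \<theta>"
    unfolding score_diff_def[abs_def]
    using assms by (intro GDERIV_diff continuously_differentiable_imp_GDERIV)
  then show ?thesis
    by (simp add: gradient_eqI)
qed

lemma maximum_in:
  assumes "has_maximum C"
  shows "maximum C \<in> C"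
  using assms unfolding has_maximum_def maximum_def by (metis GreatestI2_order)

text \<open>Restricting to a line reduces the claim to one real variable, where the sign of the
  derivative decides local growth.\<close>

lemma GDERIV_along_line:
  assumes "GDERIV f \<theta> :> g"
  shows "((\<lambda>\<epsilon>. f (\<theta> + \<epsilon> *\<^sub>R v)) has_real_derivative v \<bullet> g) (at 0)"
proof -
  have line: "((\<lambda>\<epsilon>. \<theta> + \<epsilon> *\<^sub>R v) has_derivative (\<lambda>\<epsilon>. \<epsilon> *\<^sub>R v)) (at 0)"
    by (auto intro!: derivative_eq_intros)
  have "((\<lambda>\<epsilon>. f (\<theta> + \<epsilon> *\<^sub>R v)) has_derivative (\<lambda>\<epsilon>. (\<epsilon> *\<^sub>R v) \<bullet> g)) (at 0)"
    using assms by (intro has_derivative_compose[OF line]) (simp add: gderiv_def)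
  then show ?thesis
    by (rule has_derivative_imp_has_field_derivative) simp
qed

lemma nondecreasing_along_ascent_direction:
  assumes "GDERIV f \<theta> :> g" "v \<bullet> g > 0"
  shows "\<exists>\<epsilon>\<^sub>0>0. \<forall>\<epsilon>. 0 \<le> \<epsilon> \<and> \<epsilon> \<le> \<epsilon>\<^sub>0 \<longrightarrow> f (\<theta> + \<epsilon> *\<^sub>R v) \<ge> f \<theta>"
proof -
  obtain d where "d > 0" and d: "\<And>h. 0 < h \<Longrightarrow> h < d \<Longrightarrow> f \<theta> < f (\<theta> + h *\<^sub>R v)"
    using DERIV_pos_inc_right[OF GDERIV_along_line[OF assms(1)] assms(2)] by auto
  \<comment> \<open>The strict increase holds on the open interval from 0 to \<open>d\<close>.
    Halving \<open>d\<close> gives a closed range inside it, and at 0 both sides agree.\<close>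
  have "f \<theta> \<le> f (\<theta> + \<epsilon> *\<^sub>R v)" if "0 \<le> \<epsilon>" "\<epsilon> \<le> d / 2" for \<epsilon>
    using d[of \<epsilon>] that \<open>d > 0\<close> by (cases "\<epsilon> = 0") (auto intro: less_imp_le)
  with \<open>d > 0\<close> show ?thesis
    by (intro exI[of _ "d / 2"]) auto
qed

text \<open>Chain rule. The minus sign of the descent step is absorbed into the direction, whose
  coefficient is positive once the loss is strictly decreasing in the score difference.\<close>

lemma gd_step_eq:
  assumes "GDERIV (score_diff s y z x) \<theta> :> g"
    and "(\<lambda>t. l t (maximum C)) differentiable (at (score_diff s y z x \<theta>))"
  shows "gd_step s l C x y z \<theta> \<epsilon> =
    \<theta> + \<epsilon> *\<^sub>R ((- deriv (\<lambda>t. l t (maximum C)) (score_diff s y z x \<theta>)) *\<^sub>R g)"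
proof -
  have "((\<lambda>t. l t (maximum C)) has_real_derivative
      deriv (\<lambda>t. l t (maximum C)) (score_diff s y z x \<theta>)) (at (score_diff s y z x \<theta>))"
    using assms(2) by (simp add: DERIV_deriv_iff_real_differentiable)
  from gradient_eqI[OF GDERIV_DERIV_compose[OF assms(1) this]] show ?thesis
    by (simp add: gd_step_def)
qed

text \<open>The observed function \<open>f\<close> is kept separate from the score difference that
  drives the step, so that one argument serves all three kinds of monotonicity.\<close>

lemma gd_step_nondecreasing:
  assumes "GDERIV (score_diff s y z x) \<theta> :> g"
    and "(\<lambda>t. l t (maximum C)) differentiable (at (score_diff s y z x \<theta>))"
    and "deriv (\<lambda>t. l t (maximum C)) (score_diff s y z x \<theta>) < 0"
    and "GDERIV f \<theta> :> h" "h \<bullet> g > 0"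
  shows "\<exists>\<epsilon>\<^sub>0>0. \<forall>\<epsilon>. 0 \<le> \<epsilon> \<and> \<epsilon> \<le> \<epsilon>\<^sub>0 \<longrightarrow> f (gd_step s l C x y z \<theta> \<epsilon>) \<ge> f \<theta>"
  unfolding gd_step_eq[where l = l and C = C, OF assms(1,2)]
  using assms(3-5)
  by (intro nondecreasing_along_ascent_direction) (auto simp: inner_commute mult_neg_pos)

text \<open>The minimum of finitely many positive thresholds is positive; for infinitely many the
  infimum may be 0.\<close>

lemma finite_uniform_threshold:
  fixes P :: "'a \<Rightarrow> real \<Rightarrow> bool"
  assumes "finite W" "\<forall>w\<in>W. \<exists>\<epsilon>\<^sub>0>0. \<forall>\<epsilon>. 0 \<le> \<epsilon> \<and> \<epsilon> \<le> \<epsilon>\<^sub>0 \<longrightarrow> P w \<epsilon>"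
  shows "\<exists>\<epsilon>\<^sub>0>0. \<forall>\<epsilon>. 0 \<le> \<epsilon> \<and> \<epsilon> \<le> \<epsilon>\<^sub>0 \<longrightarrow> (\<forall>w\<in>W. P w \<epsilon>)"
  using assms
proof (induction W)
  case empty
  show ?case by (intro exI[of _ 1]) simp
next
  case (insert w W)
  then obtain a b where "a > 0" "b > 0" "\<forall>\<epsilon>. 0 \<le> \<epsilon> \<and> \<epsilon> \<le> a \<longrightarrow> P w \<epsilon>"
    "\<forall>\<epsilon>. 0 \<le> \<epsilon> \<and> \<epsilon> \<le> b \<longrightarrow> (\<forall>w\<in>W. P w \<epsilon>)"
    by auto
  then show ?case
    by (intro exI[of _ "min a b"]) auto
qed

text \<open>The third implication has two forms because the thresholds for different
  \<open>w\<close> need not have a common positive lower bound: a uniform threshold is claimed for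
  finite \<open>A\<close>, and one depending on \<open>w\<close> for every \<open>A\<close>.\<close>

theorem theorem5:
  fixes A :: "'a set" and B :: "'b set" and C :: "real set"
    and s :: "'a \<Rightarrow> 'b \<Rightarrow> real ^ 'd \<Rightarrow> real"
    and l :: "real \<Rightarrow> real \<Rightarrow> real"
    and \<theta> :: "real ^ 'd"
  assumes "\<And>x y. x \<in> B \<Longrightarrow> y \<in> A \<Longrightarrow> continuously_differentiable (s y x)"
    and "\<And>c. c \<in> C \<Longrightarrow> twice_continuously_differentiable (\<lambda>t. l t c)"
    and "has_maximum C"
    and "\<And>t. deriv (\<lambda>t. l t (maximum C)) t < 0"
    and "x \<in> B" and "y \<in> A" and "z \<in> A"
  shows "(gradient (score_diff s y z x) \<theta> \<noteq> 0 \<longrightarrow> pairwise_gd_monotone s l C x y z \<theta>) \<and>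
    (gradient (score_diff s y z x) \<theta> \<bullet> gradient (s y x) \<theta> > 0 \<longrightarrow>
       individual_gd_monotone s l C x y z \<theta>) \<and>
    ((\<forall>w\<in>A - {y}. gradient (score_diff s y w x) \<theta> \<bullet> gradient (score_diff s y z x) \<theta> > 0) \<longrightarrow>
       (finite A \<longrightarrow> fully_pairwise_gd_monotone A s l C x y z \<theta>) \<and>
       (\<forall>w\<in>A - {y}. \<exists>\<epsilon>\<^sub>0>0. \<forall>\<epsilon>. 0 \<le> \<epsilon> \<and> \<epsilon> \<le> \<epsilon>\<^sub>0 \<longrightarrow>
          score_diff s y w x (gd_step s l C x y z \<theta> \<epsilon>) \<ge> score_diff s y w x \<theta>))"
proof -
  note scores = assms(1)[OF \<open>x \<in> B\<close>]
  \<comment> \<open>Smoothness is assumed only for labels in \<open>C\<close>, so it matters that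
    the maximum is attained.\<close>
  have "twice_continuously_differentiable (\<lambda>t. l t (maximum C))"
    using assms(2) maximum_in[OF assms(3)] by blast
  then have diff: "(\<lambda>t. l t (maximum C)) differentiable (at t)" for t
    by (simp add: twice_continuously_differentiable_def differentiable_on_def)
  have D: "GDERIV (score_diff s y w x) \<theta> :> gradient (score_diff s y w x) \<theta>" if "w \<in> A" for w
    using scores that \<open>y \<in> A\<close> by (intro GDERIV_score_diff)
  note step = gd_step_nondecreasing[where l = l and C = C, OF D[OF \<open>z \<in> A\<close>] diff assms(4)]
  \<comment> \<open>Here the observed function is the driving score difference itself, so the inner
    product is the squared norm of a nonzero gradient.\<close>
  have "pairwise_gd_monotone s l C x y z \<theta>" if "gradient (score_diff s y z x) \<theta> \<noteq> 0"
    unfolding pairwise_gd_monotone_def using that by (intro step[OF D[OF \<open>z \<in> A\<close>]]) simp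
  moreover have "individual_gd_monotone s l C x y z \<theta>"
    if "gradient (score_diff s y z x) \<theta> \<bullet> gradient (s y x) \<theta> > 0"
    unfolding individual_gd_monotone_def
    using that scores[OF \<open>y \<in> A\<close>]
    by (intro step[OF continuously_differentiable_imp_GDERIV]) (simp_all add: inner_commute)
  moreover have each: "\<forall>w\<in>A - {y}. \<exists>\<epsilon>\<^sub>0>0. \<forall>\<epsilon>. 0 \<le> \<epsilon> \<and> \<epsilon> \<le> \<epsilon>\<^sub>0 \<longrightarrow>
      score_diff s y w x (gd_step s l C x y z \<theta> \<epsilon>) \<ge> score_diff s y w x \<theta>"
    if "\<forall>w\<in>A - {y}. gradient (score_diff s y w x) \<theta> \<bullet> gradient (score_diff s y z x) \<theta> > 0"
    using that by (intro ballI step[OF D]) auto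
  moreover have "fully_pairwise_gd_monotone A s l C x y z \<theta>"
    if "\<forall>w\<in>A - {y}. gradient (score_diff s y w x) \<theta> \<bullet> gradient (score_diff s y z x) \<theta> > 0"
      and "finite A"
    unfolding fully_pairwise_gd_monotone_def
    using that(2) by (intro finite_uniform_threshold each[OF that(1)]) simp
  ultimately show ?thesis
    by blast
qed

end
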